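(* Let $U:\mathbb{R}^d\to\mathbb{R}$ be a $C^2$ function whose Hessian matrix satisfies $\mathrm{Hess}(U)\ge -K$ (i.e. $\mathrm{Hess}(U)(x)+K\,\mathrm{Id}$ is positive semidefinite for every $x\in\mathbb{R}^d$) for some $K>0$. Assume that $\mu(dx)=e^{-U(x)}\,dx$ is a probability measure on $\mathbb{R}^d$. If there exists a constant $L>0$ such that $$\inf_{|x-y|=L}\big\langle\nabla U(x)-\nabla U(y),x-y\big\rangle>0,$$ then $\mu$ satisfies the Poincaré inequality, i.e. there is a constant $C>0$ such that $$\mu(f^2)-\mu(f)^2\le C\int|\nabla f(x)|^2\,d\mu\qquad\text{for all } f\in C_c^2(\mathbb{R}^d).$$
   Context: $|\cdot|$ and $\langle\cdot,\cdot\rangle$ denote the Euclidean norm and inner product on $\mathbb{R}^d$; the infimum is over all $x,y\in\mathbb{R}^d$ with $|x-y|=L$; $\mu(g)=\int g\,d\mu$; $C_c^2(\mathbb{R}^d)$ is the space of compactly supported twice continuously differentiable functions on $\mathbb{R}^d$. *)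

theory Defs
  imports "HOL-Analysis.Analysis" "HOL-Probability.Probability_Measure"
begin

definition grad :: "(real ^ 'n \<Rightarrow> real) \<Rightarrow> real ^ 'n \<Rightarrow> real ^ 'n" where
  "grad f x = (\<chi> i. frechet_derivative f (at x) (axis i 1))"

lemma GDERIV_grad:
  assumes "f differentiable (at x)"
  shows "GDERIV f x :> grad f x"
proof -
  let ?D = "frechet_derivative f (at x)"
  have D: "(f has_derivative ?D) (at x)"
    using assms by (simp add: frechet_derivative_works)
  then interpret D: bounded_linear ?D by (rule has_derivative_bounded_linear)
  have "?D h = inner h (grad f x)" for h
  proof -
    have "?D h = ?D (\<Sum>i\<in>UNIV. h $ i *\<^sub>R axis i 1)"
      by (simp add: basis_expansion flip: scalar_mult_eq_scaleR)
    also have "\<dots> = inner h (grad f x)"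
      by (simp add: D.sum D.scaleR inner_vec_def grad_def)
    finally show ?thesis .
  qed
  then have "?D = (\<lambda>h. inner h (grad f x))" by auto
  with D show ?thesis by (simp add: gderiv_def)
qed

definition hessian :: "(real ^ 'n \<Rightarrow> real) \<Rightarrow> real ^ 'n \<Rightarrow> real ^ 'n ^ 'n" where
  "hessian f x = jacobian (grad f) (at x)"

definition C2 :: "(real ^ 'n \<Rightarrow> real) \<Rightarrow> bool" where
  "C2 f \<longleftrightarrow> (\<forall>x. f differentiable (at x)) \<and> (\<forall>x. grad f differentiable (at x)) \<and>
            continuous_on UNIV (hessian f)"

definition C2c :: "(real ^ 'n \<Rightarrow> real) \<Rightarrow> bool" where
  "C2c f \<longleftrightarrow> C2 f \<and> compact (closure {x. f x \<noteq> 0})"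

(* Symmetry is not part of the definition: it is only applied to Hessians of C2 functions
   plus multiples of the identity, which are symmetric by Schwarz's theorem. *)
definition pos_semidef :: "real ^ 'n ^ 'n \<Rightarrow> bool" where
  "pos_semidef A \<longleftrightarrow> (\<forall>v. 0 \<le> inner v (A *v v))"

definition gibbs_measure :: "(real ^ 'n \<Rightarrow> real) \<Rightarrow> (real ^ 'n) measure" where
  "gibbs_measure U = density lborel (\<lambda>x. ennreal (exp (- U x)))"

(* For probability measures on the Borel sets, all three integrands are bounded and
   continuous, so the Bochner integrals are never default values. *)
definition poincare_inequality :: "(real ^ 'n) measure \<Rightarrow> bool" where
  "poincare_inequality M \<longleftrightarrow>
     (\<exists>C>0. \<forall>f. C2c f \<longrightarrow>
        (\<integral>x. (f x)\<^sup>2 \<partial>M) - (\<integral>x. f x \<partial>M)\<^sup>2 \<le> C * (\<integral>x. (norm (grad f x))\<^sup>2 \<partial>M))"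

end

theory Submission
  imports Defs
begin

text \<open>
The proof combines a Lyapunov estimate at infinity with a Poincare inequality on a ball.

The two hypotheses on \<open>U\<close> force quadratic growth of \<open>inner x (grad U x)\<close>: along a ray, the radial
derivative of \<open>U\<close> gains a fixed positive amount over each step of length \<open>L\<close>, and the Hessian bound
limits what it can lose over the remaining fraction of a step. So there are \<open>a > 0\<close> and \<open>b\<close> with
\<open>inner x (grad U x) \<ge> a * (norm x)\<^sup>2 - b * norm x\<close> (\<open>growth_of_gradient\<close>).

Integrating the divergence of the vector field \<open>(h x)\<^sup>2 * exp (- U x) *\<^sub>R x\<close>, where \<open>h\<close> has compact
support, gives zero. With respect to the weight \<open>exp (- U x)\<close>, the integral of
\<open>(h x)\<^sup>2 * (inner x (grad U x) - d)\<close>, where the growth of \<open>grad U\<close> makes the second factor large far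
out, therefore equals that of the cross term \<open>2 * h x * inner x (grad h x)\<close>, which is absorbed by part
of this growth and by \<open>(norm (grad h x))\<^sup>2\<close>. This bounds the integral of \<open>h\<^sup>2\<close> by its part over a fixed
ball plus the energy of \<open>h\<close> (\<open>lyapunov_estimate\<close>). The choice of \<open>x\<close> as the vector field has two
advantages: its divergence is the dimension \<open>d\<close>, and the divergence theorem becomes the derivative at \<open>1\<close>
of the scaling rule for Lebesgue measure (\<open>integral_dilation\<close>).

A cutoff at infinity extends the estimate from \<open>h\<close> to \<open>f - m\<close> for every constant \<open>m\<close>
(\<open>estimate_add_constant\<close>). Its left-hand side is then at least the variance of \<open>f\<close>, and what remains
is to control \<open>f - m\<close> on a ball by the gradient. With \<open>m = f y\<close>, averaged over \<open>y\<close> in the ball, this is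
the Poincare inequality for Lebesgue measure on a convex set (\<open>poincare_convex\<close>); on the ball the density
\<open>exp (- U x)\<close> lies between two positive constants, so Lebesgue measure may replace the Gibbs measure there.
\<close>

section \<open>Quadratic growth of the radial derivative\<close>

text \<open>
The lower bound on the quadratic form of the derivative is integrated along the segment from \<open>y\<close> to
\<open>x\<close>, in the form of the mean value theorem.
\<close>
lemma inner_increment_lower_bound:
  fixes V :: "'a::euclidean_space \<Rightarrow> 'a"
  assumes der: "\<And>x. (V has_derivative V' x) (at x)"
    and pos: "\<And>x v. inner v (V' x v) \<ge> - K * (norm v)\<^sup>2"
  shows "inner (V x - V y) (x - y) \<ge> - K * (norm (x - y))\<^sup>2"
proof -
  define v where "v = x - y"
  define p where "p t = inner (V (y + t *\<^sub>R v)) v" for t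
  have "\<exists>z>0. z < 1 \<and> p 1 - p 0 = (1 - 0) * inner (V' (y + z *\<^sub>R v) v) v"
  proof (rule MVT2)
    fix t :: real
    have "((\<lambda>t. V (y + t *\<^sub>R v)) has_derivative (\<lambda>h. V' (y + t *\<^sub>R v) (h *\<^sub>R v))) (at t)"
      by (rule has_derivative_compose[OF _ der, where f="\<lambda>t. y + t *\<^sub>R v"])
        (auto intro!: derivative_eq_intros)
    then have "((\<lambda>t. inner (V (y + t *\<^sub>R v)) v) has_derivative (\<lambda>h. inner (V' (y + t *\<^sub>R v) (h *\<^sub>R v)) v)) (at t)"
      by (rule has_derivative_inner_left)
    moreover have "V' z (h *\<^sub>R v) = h *\<^sub>R V' z v" for z h
      using der[of z] by (simp add: has_derivative_def linear_simps)
    ultimately show "DERIV p t :> inner (V' (y + t *\<^sub>R v) v) v"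
      unfolding p_def[abs_def] by (auto intro: has_derivative_imp_has_field_derivative)
  qed simp
  then obtain z where "p 1 - p 0 = inner (V' (y + z *\<^sub>R v) v) v" by auto
  moreover have "p 1 - p 0 = inner (V x - V y) (x - y)"
    by (simp add: p_def v_def inner_diff_left)
  ultimately show ?thesis
    using pos[of v "y + z *\<^sub>R v"] by (simp add: v_def inner_commute)
qed

text \<open>
Put \<open>p t = inner (V (t *\<^sub>R u)) u\<close> for a unit vector \<open>u\<close>. Each step of length \<open>L\<close> increases \<open>p\<close> by at least
\<open>c / L\<close>, so \<open>p\<close> grows at the average rate \<open>c / L\<^sup>2\<close>; a piece shorter than \<open>L\<close> costs at most \<open>K * L\<close>.
The constant \<open>b\<close> collects this cost, the loss from rounding \<open>norm x / L\<close> down, and the value \<open>p 0\<close>.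
\<close>
lemma growth_of_gradient:
  fixes V :: "'a::euclidean_space \<Rightarrow> 'a"
  assumes lower: "\<And>x y. inner (V x - V y) (x - y) \<ge> - K * (norm (x - y))\<^sup>2"
    and at_L: "\<And>x y. norm (x - y) = L \<Longrightarrow> inner (V x - V y) (x - y) \<ge> c"
    and "L > 0" "K \<ge> 0" "c > 0"
  obtains b where "\<And>x. inner x (V x) \<ge> c / L\<^sup>2 * (norm x)\<^sup>2 - b * norm x"
proof
  fix x :: 'a
  show "inner x (V x) \<ge> c / L\<^sup>2 * (norm x)\<^sup>2 - (norm (V 0) + c / L + K * L) * norm x"
  proof (cases "x = 0")
    case False
    define r where "r = norm x"
    define u where "u = x /\<^sub>R r"
    have r: "r > 0" and u: "norm u = 1" and x: "x = r *\<^sub>R u"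
      using False by (auto simp: r_def u_def)
    define p where "p t = inner (V (t *\<^sub>R u)) u" for t
    have diff: "inner (V (t *\<^sub>R u) - V (s *\<^sub>R u)) (t *\<^sub>R u - s *\<^sub>R u) = (t - s) * (p t - p s)" for t s
      by (simp add: p_def flip: scaleR_diff_left) (simp add: inner_diff_left)
    have nrm: "norm (t *\<^sub>R u - s *\<^sub>R u) = \<bar>t - s\<bar>" for t s
      using u by (simp flip: scaleR_diff_left)
    \<comment> \<open>As \<open>diff\<close> carries a factor \<open>t - s = L\<close>, the gain \<open>c\<close> becomes \<open>c / L\<close>.\<close>
    have step: "p (t + L) - p t \<ge> c / L" for t
      using at_L[of "(t + L) *\<^sub>R u" "t *\<^sub>R u"] \<open>L > 0\<close>
      unfolding diff nrm by (simp add: field_simps)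
    have short: "p t - p s \<ge> - K * (t - s)" if "t \<ge> s" for t s
    proof (cases "t = s")
      case False
      then have "t - s > 0" using that by simp
      moreover have "(t - s) * (p t - p s) \<ge> (t - s) * (- K * (t - s))"
        using lower[of "s *\<^sub>R u" "t *\<^sub>R u"] lower[of "t *\<^sub>R u" "s *\<^sub>R u"]
        unfolding diff nrm by (simp add: power2_eq_square algebra_simps)
      ultimately show ?thesis by (simp only: mult_le_cancel_left_pos)
    qed auto
    have steps: "p (t + real n * L) - p t \<ge> real n * (c / L)" for t n
    proof (induction n)
      case (Suc n)
      then show ?case using step[of "t + real n * L"] by (simp add: algebra_simps)
    qed simp
    define n where "n = nat \<lfloor>r / L\<rfloor>"
    define q where "q = r - real n * L"
    have n: "real n \<le> r / L" "r / L - 1 < real n"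
      using r \<open>L > 0\<close> by (auto simp: n_def)
    have q: "0 \<le> q" "q \<le> L"
      using n \<open>L > 0\<close> by (auto simp: q_def field_simps)
    have "p r = p (q + real n * L)" by (simp add: q_def)
    then have "p r \<ge> p q + real n * (c / L)" using steps[where t=q and n=n] by simp
    moreover have "p q \<ge> p 0 - K * L"
      using short[of 0 q] q mult_left_mono[OF q(2) \<open>K \<ge> 0\<close>] by simp
    moreover have "p 0 \<ge> - norm (V 0)"
      using Cauchy_Schwarz_ineq2[of "V 0" u] u by (simp add: p_def)
    moreover have "real n * (c / L) \<ge> (r / L - 1) * (c / L)"
      using n(2) \<open>c > 0\<close> \<open>L > 0\<close> by (intro mult_right_mono) auto
    ultimately have "p r \<ge> c / L\<^sup>2 * r - (norm (V 0) + c / L + K * L)"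
      by (simp add: algebra_simps power2_eq_square)
    then have "r * p r \<ge> r * (c / L\<^sup>2 * r - (norm (V 0) + c / L + K * L))"
      using r by (intro mult_left_mono) auto
    moreover have "r * p r = inner x (V x)"
      by (simp add: p_def x inner_commute)
    ultimately show ?thesis
      by (simp add: r_def algebra_simps power2_eq_square)
  qed simp
qed

section \<open>Integration by parts for the dilation field\<close>

lemma integrable_compactly_supported:
  fixes G :: "'a::euclidean_space \<Rightarrow> real"
  assumes "continuous_on UNIV G" and "\<And>x. norm x > R \<Longrightarrow> G x = 0"
  shows "integrable lborel G"
proof -
  have "integrable lborel (\<lambda>x. indicator (cball 0 R) x *\<^sub>R G x)"
    using assms(1) by (intro borel_integrable_compact) (auto intro: continuous_on_subset)
  moreover have "(\<lambda>x. indicator (cball 0 R) x *\<^sub>R G x) = G"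
    using assms(2) by (force simp: indicator_def fun_eq_iff)
  ultimately show ?thesis by simp
qed

lemma lborel_integral_scaleR:
  fixes G :: "'a::euclidean_space \<Rightarrow> real"
  assumes "G \<in> borel_measurable borel" "c > 0"
  shows "(\<integral>x. G x \<partial>lborel) = c ^ DIM('a) * (\<integral>x. G (c *\<^sub>R x) \<partial>lborel)"
  using assms
  by (subst lborel_affine[of c 0]) (auto simp: integral_density integral_distr)

lemma GDERIV_continuous: "(\<And>x. GDERIV f x :> g x) \<Longrightarrow> continuous_on UNIV f"
  by (auto simp: gderiv_def intro!: continuous_at_imp_continuous_on has_derivative_continuous)

lemma GDERIV_line:
  assumes "\<And>x. GDERIV f x :> g x"
  shows "((\<lambda>t. f (y + t *\<^sub>R v)) has_real_derivative inner v (g (y + t *\<^sub>R v))) (at t within T)"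
proof -
  have "((\<lambda>t. f (y + t *\<^sub>R v)) has_derivative (\<lambda>h. inner (h *\<^sub>R v) (g (y + t *\<^sub>R v)))) (at t within T)"
    by (rule has_derivative_compose[where f="\<lambda>t. y + t *\<^sub>R v"])
        (use assms in \<open>auto simp: gderiv_def intro!: derivative_eq_intros\<close>)
  then show ?thesis by (rule has_derivative_imp_has_field_derivative) simp
qed

text \<open>
The divergence theorem for the vector field \<open>G x *\<^sub>R x\<close>. Rescaling shows that the integral of
\<open>G (s *\<^sub>R x)\<close> is \<open>s\<close> to the power \<open>- DIM('a)\<close> times that of \<open>G\<close>; both sides are differentiated at
\<open>s = 1\<close>, through the difference quotients along \<open>s n = 1 + 1 / Suc n\<close>. As \<open>s n > 1\<close>, the quotients
vanish outside the ball that carries \<open>G\<close>, which gives the dominating function.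
\<close>
lemma integral_dilation:
  fixes G :: "'a::euclidean_space \<Rightarrow> real"
  assumes der: "\<And>x. GDERIV G x :> g x" and cont: "continuous_on UNIV g"
    and supp: "\<And>x. norm x > R \<Longrightarrow> G x = 0"
  shows "(\<integral>x. inner x (g x) \<partial>lborel) = - real DIM('a) * (\<integral>x. G x \<partial>lborel)"
proof -
  define s where "s n = 1 + 1 / real (Suc n)" for n
  have s: "s n > 1" "s n \<le> 2" for n by (auto simp: s_def field_simps)
  have s_lim: "filterlim s (at 1) sequentially"
  proof -
    have "(\<lambda>n. 1 / real (Suc n)) \<longlonglongrightarrow> 0" by (rule LIMSEQ_Suc[OF lim_1_over_n])
    from tendsto_add[OF tendsto_const this, of 1] show ?thesis
      unfolding filterlim_at by (auto simp: s_def[abs_def])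
  qed
  have quot: "(\<lambda>n. (p (s n) - p 1) * real (Suc n)) \<longlonglongrightarrow> D" if "DERIV p 1 :> D" for p D
  proof -
    have "((\<lambda>t. (p t - p 1) / (t - 1)) \<longlongrightarrow> D) (at 1)"
      using that by (simp add: has_field_derivative_iff)
    from filterlim_compose[OF this s_lim] show ?thesis by (simp add: s_def)
  qed
  have G_cont: "continuous_on UNIV G" using GDERIV_continuous[OF der] .
  have G_int: "integrable lborel G"
    by (rule integrable_compactly_supported[OF G_cont supp])
  have G_meas [measurable]: "G \<in> borel_measurable borel"
    using G_cont by (rule borel_measurable_continuous_onI)
  have g_meas [measurable]: "g \<in> borel_measurable borel"
    using cont by (rule borel_measurable_continuous_onI)
  have "compact (g ` cball 0 (2 * R))"
    using cont by (intro compact_continuous_image) (auto intro: continuous_on_subset)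
  then obtain M where M: "\<And>x. norm x \<le> 2 * R \<Longrightarrow> norm (g x) \<le> M"
    using compact_imp_bounded bounded_iff by (metis image_eqI mem_cball_0)
  define I where "I = (\<integral>x. G x \<partial>lborel)"
  have lim1: "(\<lambda>n. \<integral>x. (G (s n *\<^sub>R x) - G x) * real (Suc n) \<partial>lborel) \<longlonglongrightarrow> (\<integral>x. inner x (g x) \<partial>lborel)"
  proof (rule integral_dominated_convergence)
    show "integrable lborel (\<lambda>x::'a. indicator (cball 0 R) x *\<^sub>R (norm x * M))"
      by (intro borel_integrable_compact continuous_intros) auto
    show "AE x in lborel. (\<lambda>n. (G (s n *\<^sub>R x) - G x) * real (Suc n)) \<longlonglongrightarrow> inner x (g x)"
    proof (rule AE_I2)
      fix x
      have "DERIV (\<lambda>t. G (0 + t *\<^sub>R x)) 1 :> inner x (g (0 + 1 *\<^sub>R x))"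
        by (rule GDERIV_line[OF der])
      from quot[OF this] show "(\<lambda>n. (G (s n *\<^sub>R x) - G x) * real (Suc n)) \<longlonglongrightarrow> inner x (g x)" by simp
    qed
    show "AE x in lborel. norm ((G (s n *\<^sub>R x) - G x) * real (Suc n)) \<le> indicator (cball 0 R) x *\<^sub>R (norm x * M)" for n
    proof (rule AE_I2)
      fix x
      show "norm ((G (s n *\<^sub>R x) - G x) * real (Suc n)) \<le> indicator (cball 0 R) x *\<^sub>R (norm x * M)"
      proof (cases "norm x \<le> R")
        case True
        have "\<exists>z>1. z < s n \<and> G (0 + s n *\<^sub>R x) - G (0 + 1 *\<^sub>R x) = (s n - 1) * inner x (g (0 + z *\<^sub>R x))"
          using s[of n] by (intro MVT2 GDERIV_line[OF der])
        then obtain z where z: "1 < z" "z < s n" "G (s n *\<^sub>R x) - G x = (s n - 1) * inner x (g (z *\<^sub>R x))"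
          by auto
        have "norm (z *\<^sub>R x) \<le> 2 * R"
          using z s[of n] True by (auto intro!: mult_mono)
        then have "\<bar>inner x (g (z *\<^sub>R x))\<bar> \<le> norm x * M"
          by (intro order_trans[OF Cauchy_Schwarz_ineq2] mult_left_mono M) auto
        moreover have "(G (s n *\<^sub>R x) - G x) * real (Suc n) = inner x (g (z *\<^sub>R x))"
          unfolding z(3) by (simp add: s_def)
        ultimately show ?thesis using True by simp
      next
        case False
        have "norm (s n *\<^sub>R x) > R"
          using False s[of n] mult_right_mono[of 1 "s n" "norm x"] by auto
        then show ?thesis using supp False by simp
      qed
    qed
  qed auto
  have "(\<integral>x. (G (s n *\<^sub>R x) - G x) * real (Suc n) \<partial>lborel) = (inverse (s n ^ DIM('a)) * I - inverse (1 ^ DIM('a)) * I) * real (Suc n)" for n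
  proof -
    have "integrable lborel (\<lambda>x. G (s n *\<^sub>R x))"
    proof (rule integrable_compactly_supported)
      show "continuous_on UNIV (\<lambda>x. G (s n *\<^sub>R x))"
        by (rule continuous_on_compose2[OF G_cont]) (auto intro!: continuous_intros)
      show "G (s n *\<^sub>R x) = 0" if "norm x > R" for x
        using that s[of n] mult_right_mono[of 1 "s n" "norm x"] by (intro supp) auto
    qed
    then show ?thesis
      using G_int lborel_integral_scaleR[OF G_meas, of "s n"] s[of n] by (simp add: I_def field_simps)
  qed
  moreover have "(\<lambda>n. (inverse (s n ^ DIM('a)) * I - inverse (1 ^ DIM('a)) * I) * real (Suc n)) \<longlonglongrightarrow> - real DIM('a) * I"
    by (rule quot) (auto intro!: derivative_eq_intros)
  ultimately show ?thesis
    using lim1 LIMSEQ_unique unfolding I_def by fastforce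
qed

lemma gradient_eq_0_outside_support:
  assumes der: "\<And>x. GDERIV h x :> h' x" and supp: "\<And>x. norm x > R \<Longrightarrow> h x = 0"
    and "norm x > R"
  shows "h' x = 0"
proof -
  have "open {x::'a. norm x > R}"
    using open_Collect_less[of "\<lambda>_. R" norm] by (simp add: continuous_on_norm_id)
  then have "(h has_derivative (\<lambda>v. 0)) (at x)"
    using assms(3) supp by (intro has_derivative_transform_within_open[where f="\<lambda>_. 0" and g=h]) auto
  with der[of x] have "(\<lambda>v. inner v (h' x)) = (\<lambda>v. 0)"
    unfolding gderiv_def by (rule has_derivative_unique)
  then have "inner (h' x) (h' x) = 0" by metis
  then show ?thesis by simp
qed

text \<open>
The product rule turns the dilation identity for \<open>G = h\<^sup>2 * exp (- U)\<close> into a balance between the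
radial derivative of \<open>U\<close> and that of \<open>h\<close>.
\<close>
lemma integral_weighted_dilation:
  fixes h U :: "'a::euclidean_space \<Rightarrow> real"
  assumes h: "\<And>x. GDERIV h x :> h' x" "continuous_on UNIV h'" "\<And>x. norm x > R \<Longrightarrow> h x = 0"
    and U: "\<And>x. GDERIV U x :> U' x" "continuous_on UNIV U'"
  shows "integrable lborel (\<lambda>x. (2 * h x * inner x (h' x) - (h x)\<^sup>2 * (inner x (U' x) - real DIM('a))) * exp (- U x))"
    and "(\<integral>x. (2 * h x * inner x (h' x) - (h x)\<^sup>2 * (inner x (U' x) - real DIM('a))) * exp (- U x) \<partial>lborel) = 0"
proof -
  define G where "G x = (h x)\<^sup>2 * exp (- U x)" for x
  define g where "g x = exp (- U x) *\<^sub>R ((2 * h x) *\<^sub>R h' x - (h x)\<^sup>2 *\<^sub>R U' x)" for x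
  have hc [continuous_intros]: "continuous_on UNIV h" and Uc [continuous_intros]: "continuous_on UNIV U"
    using GDERIV_continuous h(1) U(1) by blast+
  have G_der: "GDERIV G x :> g x" for x
    using h(1)[of x] U(1)[of x] unfolding gderiv_def G_def g_def
    by (auto intro!: derivative_eq_intros simp: fun_eq_iff inner_diff_right algebra_simps)
  have g_cont: "continuous_on UNIV g"
    unfolding g_def using h(2) U(2) by (intro continuous_intros)
  have G_supp: "G x = 0" if "norm x > R" for x using h(3)[OF that] by (simp add: G_def)
  have int1: "integrable lborel G"
    by (rule integrable_compactly_supported[OF GDERIV_continuous[OF G_der] G_supp])
  have int2: "integrable lborel (\<lambda>x. inner x (g x))"
    using g_cont gradient_eq_0_outside_support[OF G_der G_supp]
    by (intro integrable_compactly_supported[where R=R] continuous_intros) auto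
  have eq: "(2 * h x * inner x (h' x) - (h x)\<^sup>2 * (inner x (U' x) - real DIM('a))) * exp (- U x)
      = inner x (g x) + real DIM('a) * G x" for x
    by (simp add: G_def g_def inner_diff_right algebra_simps)
  show "integrable lborel (\<lambda>x. (2 * h x * inner x (h' x) - (h x)\<^sup>2 * (inner x (U' x) - real DIM('a))) * exp (- U x))"
    unfolding eq using int1 int2 by simp
  show "(\<integral>x. (2 * h x * inner x (h' x) - (h x)\<^sup>2 * (inner x (U' x) - real DIM('a))) * exp (- U x) \<partial>lborel) = 0"
    unfolding eq using int1 int2 integral_dilation[OF G_der g_cont G_supp] by simp
qed

text \<open>
The gradient is carried as a second argument, so that the estimates below apply to whatever expression
a differentiation rule produces for it.
\<close>
definition C1c_gradient :: "('a::euclidean_space \<Rightarrow> real) \<Rightarrow> ('a \<Rightarrow> 'a) \<Rightarrow> bool" where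
  "C1c_gradient f g \<longleftrightarrow> (\<forall>x. GDERIV f x :> g x) \<and> continuous_on UNIV g \<and> (\<exists>\<rho>. \<forall>x. norm x > \<rho> \<longrightarrow> f x = 0)"

lemma C1c_gradientI:
  assumes "\<And>x. GDERIV f x :> g x" "continuous_on UNIV g" "\<And>x. norm x > \<rho> \<Longrightarrow> f x = 0"
  shows "C1c_gradient f g"
  using assms by (auto simp: C1c_gradient_def)

text \<open>
By the arithmetic-geometric mean inequality, the cross term of the weighted dilation identity costs
half of the growth \<open>a * (norm x)\<^sup>2 * (h x)\<^sup>2\<close> and \<open>2 / a\<close> times the energy. The remaining weight
\<open>a / 2 * (norm x)\<^sup>2 - b * norm x - d\<close> is at least \<open>1\<close> outside a large ball, and inside it the first
term on the right compensates for its negative values.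
\<close>
lemma lyapunov_estimate:
  fixes U :: "'a::euclidean_space \<Rightarrow> real"
  assumes U: "\<And>x. GDERIV U x :> U' x" "continuous_on UNIV U'"
    and "a > 0" and growth: "\<And>x. inner x (U' x) \<ge> a * (norm x)\<^sup>2 - b * norm x"
  obtains R C\<^sub>1 C\<^sub>2 :: real where "R > 0" "C\<^sub>1 > 0" "C\<^sub>2 > 0"
    and "\<And>h h'. C1c_gradient h h' \<Longrightarrow>
      (\<integral>x. (h x)\<^sup>2 * exp (- U x) \<partial>lborel)
        \<le> C\<^sub>1 * (\<integral>x. (indicator (cball 0 R) x * (h x)\<^sup>2) * exp (- U x) \<partial>lborel)
          + C\<^sub>2 * (\<integral>x. (norm (h' x))\<^sup>2 * exp (- U x) \<partial>lborel)"
proof -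
  define d where "d = real DIM('a)"
  \<comment> \<open>Beyond \<open>R\<close>, the quadratic term \<open>a / 2 * (norm x)\<^sup>2\<close> exceeds \<open>(\<bar>b\<bar> + d + 1) * norm x\<close>,
    and \<open>norm x \<ge> 1\<close> lets \<open>(d + 1) * norm x\<close> dominate the constants \<open>d + 1\<close>.\<close>
  define R where "R = max 1 (2 * (\<bar>b\<bar> + d + 1) / a)"
  define B where "B = \<bar>b\<bar> * R + d + 1"
  have R: "R \<ge> 1" "2 * (\<bar>b\<bar> + d + 1) / a \<le> R" by (auto simp: R_def)
  have "d \<ge> 0" by (simp add: d_def)
  with R have B: "B > 0" unfolding B_def by (intro add_nonneg_pos add_nonneg_nonneg mult_nonneg_nonneg) auto
  have quad: "B * indicator (cball 0 R) x + (a / 2 * (norm x)\<^sup>2 - b * norm x - d) \<ge> 1" for x :: 'a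
  proof -
    have b: "b * norm x \<le> \<bar>b\<bar> * norm x" by (intro mult_right_mono) auto
    show ?thesis
    proof (cases "norm x \<le> R")
      case True
      have "\<bar>b\<bar> * norm x \<le> \<bar>b\<bar> * R" using True by (intro mult_left_mono) auto
      moreover have "a / 2 * (norm x)\<^sup>2 \<ge> 0" using \<open>a > 0\<close> by simp
      ultimately show ?thesis using b True by (simp add: B_def)
    next
      case False
      have "\<bar>b\<bar> + d + 1 \<le> a / 2 * R" using R(2) \<open>a > 0\<close> by (simp add: field_simps)
      also have "\<dots> \<le> a / 2 * norm x" using False \<open>a > 0\<close> by (intro mult_left_mono) auto
      finally have "(\<bar>b\<bar> + d + 1) * norm x \<le> a / 2 * norm x * norm x" by (intro mult_right_mono) auto
      moreover have "(d + 1) * norm x \<ge> (d + 1) * 1"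
        using False R \<open>d \<ge> 0\<close> by (intro mult_left_mono) auto
      ultimately show ?thesis using b False by (simp add: power2_eq_square algebra_simps)
    qed
  qed
  have main: "(\<integral>x. (h x)\<^sup>2 * exp (- U x) \<partial>lborel)
        \<le> B * (\<integral>x. (indicator (cball 0 R) x * (h x)\<^sup>2) * exp (- U x) \<partial>lborel)
          + (2 / a) * (\<integral>x. (norm (h' x))\<^sup>2 * exp (- U x) \<partial>lborel)"
    if "C1c_gradient h h'" for h h'
  proof -
    from that obtain \<rho> where h: "\<And>x. GDERIV h x :> h' x" "continuous_on UNIV h'" "\<And>x. norm x > \<rho> \<Longrightarrow> h x = 0"
      by (auto simp: C1c_gradient_def)
    define T where "T x = 2 * h x * inner x (h' x) - (h x)\<^sup>2 * (inner x (U' x) - d)" for x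
    have hc [continuous_intros]: "continuous_on UNIV h" and Uc [continuous_intros]: "continuous_on UNIV U"
      using GDERIV_continuous h(1) U(1) by blast+
    have pw: "(h x)\<^sup>2 \<le> B * (indicator (cball 0 R) x * (h x)\<^sup>2) + (2 / a) * (norm (h' x))\<^sup>2 - T x" for x
    proof -
      have "2 * h x * inner x (h' x) \<le> 2 * \<bar>h x\<bar> * (norm x * norm (h' x))"
      proof -
        have "2 * h x * inner x (h' x) \<le> \<bar>2 * h x * inner x (h' x)\<bar>" by simp
        also have "\<dots> \<le> 2 * \<bar>h x\<bar> * (norm x * norm (h' x))"
          unfolding abs_mult by (intro mult_mono Cauchy_Schwarz_ineq2) auto
        finally show ?thesis .
      qed
      also have "\<dots> \<le> a / 2 * (norm x)\<^sup>2 * (h x)\<^sup>2 + (2 / a) * (norm (h' x))\<^sup>2"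
      proof -
        have "0 \<le> (a * norm x * \<bar>h x\<bar> - 2 * norm (h' x))\<^sup>2 / (2 * a)" using \<open>a > 0\<close> by simp
        also have "\<dots> = a / 2 * (norm x)\<^sup>2 * (h x)\<^sup>2 + (2 / a) * (norm (h' x))\<^sup>2 - 2 * \<bar>h x\<bar> * (norm x * norm (h' x))"
          using \<open>a > 0\<close> by (simp add: power2_diff power_mult_distrib field_simps power2_eq_square)
        finally show ?thesis by simp
      qed
      finally have 1: "2 * h x * inner x (h' x) \<le> a / 2 * (norm x)\<^sup>2 * (h x)\<^sup>2 + (2 / a) * (norm (h' x))\<^sup>2" .
      have 2: "(h x)\<^sup>2 * (inner x (U' x) - d) \<ge> (h x)\<^sup>2 * (a * (norm x)\<^sup>2 - b * norm x - d)"
        using growth[of x] by (intro mult_left_mono) auto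
      have 3: "(h x)\<^sup>2 * (B * indicator (cball 0 R) x + (a / 2 * (norm x)\<^sup>2 - b * norm x - d)) \<ge> (h x)\<^sup>2 * 1"
        using quad by (intro mult_left_mono) auto
      show ?thesis using 1 2 3 unfolding T_def by (simp add: algebra_simps)
    qed
    have int_h: "integrable lborel (\<lambda>x. (h x)\<^sup>2 * exp (- U x))"
      using h(3) by (intro integrable_compactly_supported[where R=\<rho>] continuous_intros) auto
    have int_ind: "integrable lborel (\<lambda>x. (indicator (cball 0 R) x * (h x)\<^sup>2) * exp (- U x))"
      using integrable_mult_indicator[OF _ int_h, of "cball 0 R"] by (simp add: mult.assoc)
    have int_h': "integrable lborel (\<lambda>x. (norm (h' x))\<^sup>2 * exp (- U x))"
      using gradient_eq_0_outside_support[OF h(1) h(3)] h(2)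
      by (intro integrable_compactly_supported[where R=\<rho>] continuous_intros) auto
    have int_T: "integrable lborel (\<lambda>x. T x * exp (- U x))" "(\<integral>x. T x * exp (- U x) \<partial>lborel) = 0"
      using integral_weighted_dilation[OF h U] by (simp_all add: T_def d_def)
    have "(\<integral>x. (h x)\<^sup>2 * exp (- U x) \<partial>lborel) \<le>
        (\<integral>x. B * ((indicator (cball 0 R) x * (h x)\<^sup>2) * exp (- U x)) + (2 / a) * ((norm (h' x))\<^sup>2 * exp (- U x)) - T x * exp (- U x) \<partial>lborel)"
    proof (rule integral_mono)
      fix x
      show "(h x)\<^sup>2 * exp (- U x) \<le> B * ((indicator (cball 0 R) x * (h x)\<^sup>2) * exp (- U x)) + (2 / a) * ((norm (h' x))\<^sup>2 * exp (- U x)) - T x * exp (- U x)"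
        using mult_right_mono[OF pw[of x], of "exp (- U x)"] by (simp only: algebra_simps exp_ge_zero)
    qed (use int_h int_ind int_h' int_T in auto)
    then show ?thesis using int_h int_ind int_h' int_T by simp
  qed
  show thesis
  proof (rule that[of R B "2 / a"])
    show "R > 0" "B > 0" "2 / a > 0" using R B \<open>a > 0\<close> by auto
  qed (rule main)
qed

section \<open>Cutoff at infinity\<close>

text \<open>
At the kink \<open>s = 0\<close> no differentiation rule applies; the bound \<open>(y - s)\<^sup>2\<close> on the error of the linear
approximation covers all \<open>s\<close> at once.
\<close>
lemma DERIV_max_power2: "((\<lambda>s. (max 0 s)\<^sup>2) has_real_derivative 2 * max 0 s) (at s)"
proof -
  have "((\<lambda>y. ((max 0 y)\<^sup>2 - (max 0 s)\<^sup>2) / (y - s) - 2 * max 0 s) \<longlongrightarrow> 0) (at s)"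
  proof (rule tendsto_0_le)
    show "((\<lambda>y. y - s) \<longlongrightarrow> 0) (at s)" by (auto intro!: tendsto_eq_intros)
    show "\<forall>\<^sub>F y in at s. norm (((max 0 y)\<^sup>2 - (max 0 s)\<^sup>2) / (y - s) - 2 * max 0 s) \<le> norm (y - s) * 1"
      unfolding eventually_at
    proof (intro exI[of _ 1] conjI ballI impI, goal_cases)
      case (2 y)
      then have ne: "y - s \<noteq> 0" by auto
      have "((max 0 y)\<^sup>2 - (max 0 s)\<^sup>2) / (y - s) - 2 * max 0 s
          = ((max 0 y)\<^sup>2 - (max 0 s)\<^sup>2 - 2 * max 0 s * (y - s)) / (y - s)"
        using ne by (simp add: field_simps)
      moreover have "\<bar>(max 0 y)\<^sup>2 - (max 0 s)\<^sup>2 - 2 * max 0 s * (y - s)\<bar> \<le> (y - s)\<^sup>2"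
      proof -
        consider "y \<ge> 0" "s \<ge> 0" | "y \<ge> 0" "s < 0" | "y < 0" "s \<ge> 0" | "y < 0" "s < 0" by linarith
        then show ?thesis
        proof cases
          case 1
          then have "(max 0 y)\<^sup>2 - (max 0 s)\<^sup>2 - 2 * max 0 s * (y - s) = (y - s)\<^sup>2"
            by (simp add: max_def power2_eq_square algebra_simps)
          then show ?thesis by simp
        next
          case 2
          then have "y\<^sup>2 \<le> (y - s)\<^sup>2" by (intro power_mono) auto
          then show ?thesis using 2 by (simp add: max_def)
        next
          case 3
          then have "s * y \<le> 0" by (simp add: mult_nonneg_nonpos)
          then have "\<bar>s\<^sup>2 - 2 * (s * y)\<bar> = s\<^sup>2 - 2 * (s * y)"
            using zero_le_power2[of s] by (intro abs_of_nonneg) linarith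
          moreover have "(max 0 y)\<^sup>2 - (max 0 s)\<^sup>2 - 2 * max 0 s * (y - s) = s\<^sup>2 - 2 * (s * y)"
            using 3 by (simp add: max_def power2_eq_square algebra_simps)
          ultimately show ?thesis by (simp add: power2_diff)
        qed (simp add: max_def)
      qed
      ultimately show ?case
        using ne by (simp add: abs_divide divide_le_eq power2_eq_square flip: abs_mult)
    qed simp
  qed
  then show ?thesis
    unfolding has_field_derivative_iff by (rule LIM_zero_cancel)
qed

text \<open>
Any continuously differentiable function of compact support with value \<open>1\<close> at the origin serves: the
rescaled cutoffs \<open>bump (x / n)\<close> then tend to \<open>1\<close> pointwise by continuity at the
origin. The square makes the positive part differentiable where it vanishes.
\<close>
definition bump :: "'a::euclidean_space \<Rightarrow> real" where
  "bump x = (max 0 (1 - inner x x))\<^sup>2"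

definition bump_grad :: "'a::euclidean_space \<Rightarrow> 'a" where
  "bump_grad x = (- 4 * max 0 (1 - inner x x)) *\<^sub>R x"

lemma GDERIV_bump: "GDERIV bump x :> bump_grad x"
proof -
  have "((\<lambda>y. 1 - inner y y) has_derivative (\<lambda>v. - 2 * inner v x)) (at x)"
    by (auto intro!: derivative_eq_intros simp: inner_commute)
  from has_derivative_compose[OF this DERIV_max_power2[unfolded has_field_derivative_def]]
  show ?thesis
    by (auto simp: gderiv_def bump_def[abs_def] bump_grad_def algebra_simps)
qed

lemma continuous_bump_grad: "continuous_on UNIV bump_grad"
  unfolding bump_grad_def by (intro continuous_intros)

lemma bump_eq_0: "norm x \<ge> 1 \<Longrightarrow> bump x = 0"
  using power_mono[of 1 "norm x" 2] by (simp add: bump_def power2_norm_eq_inner max_def)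

lemma bump_le_1: "\<bar>bump x\<bar> \<le> 1"
  by (auto simp: bump_def max_def intro!: power_le_one)

lemma norm_bump_grad_le: "norm (bump_grad x) \<le> 4"
proof (cases "norm x \<le> 1")
  case True
  have "max 0 (1 - inner x x) * norm x \<le> 1 * 1"
    using True by (intro mult_mono) auto
  then show ?thesis by (simp add: bump_grad_def)
next
  case False
  then have "1 - inner x x \<le> 0"
    using power_mono[of 1 "norm x" 2] by (simp add: power2_norm_eq_inner)
  then show ?thesis by (simp add: bump_grad_def max_def)
qed

lemma integral_weighted_bounded_convergence:
  fixes \<phi> :: "nat \<Rightarrow> 'a \<Rightarrow> real"
  assumes w: "integrable M w"
    and meas: "\<And>n. \<phi> n \<in> borel_measurable M" "\<psi> \<in> borel_measurable M"
    and bound: "\<And>n x. \<bar>\<phi> n x\<bar> \<le> B"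
    and lim: "\<And>x. (\<lambda>n. \<phi> n x) \<longlonglongrightarrow> \<psi> x"
  shows "(\<lambda>n. \<integral>x. \<phi> n x * w x \<partial>M) \<longlonglongrightarrow> (\<integral>x. \<psi> x * w x \<partial>M)"
proof (rule integral_dominated_convergence)
  show "integrable M (\<lambda>x. B * \<bar>w x\<bar>)" using w by auto
  show "AE x in M. norm (\<phi> n x * w x) \<le> B * \<bar>w x\<bar>" for n
    using bound by (auto simp: abs_mult intro!: mult_right_mono)
  show "AE x in M. (\<lambda>n. \<phi> n x * w x) \<longlonglongrightarrow> \<psi> x * w x"
    using lim by (auto intro!: tendsto_mult)
qed (use meas w in auto)

lemma bounded_compactly_supported:
  fixes G :: "'a::euclidean_space \<Rightarrow> 'b::real_normed_vector"
  assumes "continuous_on UNIV G" "\<And>x. norm x > R \<Longrightarrow> G x = 0"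
  obtains B where "B \<ge> 0" "\<And>x. norm (G x) \<le> B"
proof -
  have "compact (G ` cball 0 R)"
    using assms(1) by (intro compact_continuous_image) (auto intro: continuous_on_subset)
  then obtain B where B: "\<And>x. norm x \<le> R \<Longrightarrow> norm (G x) \<le> B"
    using compact_imp_bounded bounded_iff by (metis image_eqI mem_cball_0)
  show thesis
  proof (rule that[of "max 0 B"])
    show "norm (G x) \<le> max 0 B" for x
      using B[of x] assms(2)[of x] by (cases "norm x \<le> R") auto
  qed simp
qed

text \<open>
The function \<open>f - m\<close> is the pointwise limit of the compactly supported \<open>f - m * bump (x / n)\<close>, whose
gradients converge to that of \<open>f\<close> because the gradient of the cutoff carries a factor \<open>1 / n\<close>. All
functions involved are bounded uniformly in \<open>n\<close> and the weight is integrable, so the three integrals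
converge.
\<close>
lemma estimate_add_constant:
  fixes f U :: "'a::euclidean_space \<Rightarrow> real"
  assumes est: "\<And>h h'. C1c_gradient h h' \<Longrightarrow>
      (\<integral>x. (h x)\<^sup>2 * exp (- U x) \<partial>lborel)
        \<le> C\<^sub>1 * (\<integral>x. (indicator (cball 0 R) x * (h x)\<^sup>2) * exp (- U x) \<partial>lborel)
          + C\<^sub>2 * (\<integral>x. (norm (h' x))\<^sup>2 * exp (- U x) \<partial>lborel)"
    and w: "integrable lborel (\<lambda>x. exp (- U x))"
    and f_C1c: "C1c_gradient f f'"
  shows "(\<integral>x. (f x - m)\<^sup>2 * exp (- U x) \<partial>lborel)
        \<le> C\<^sub>1 * (\<integral>x. (indicator (cball 0 R) x * (f x - m)\<^sup>2) * exp (- U x) \<partial>lborel)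
          + C\<^sub>2 * (\<integral>x. (norm (f' x))\<^sup>2 * exp (- U x) \<partial>lborel)"
proof -
  from f_C1c obtain \<rho> where f: "\<And>x. GDERIV f x :> f' x" "continuous_on UNIV f'" "\<And>x. norm x > \<rho> \<Longrightarrow> f x = 0"
    by (auto simp: C1c_gradient_def)
  define r where "r n = 1 / real (Suc n)" for n
  define h where "h n x = f x - m * bump (r n *\<^sub>R x)" for n x
  define h' where "h' n x = f' x - (m * r n) *\<^sub>R bump_grad (r n *\<^sub>R x)" for n x
  have r: "0 < r n" "r n \<le> 1" for n by (auto simp: r_def)
  have r_lim: "r \<longlonglongrightarrow> 0" unfolding r_def[abs_def] by (rule LIMSEQ_Suc[OF lim_1_over_n])
  have fc: "continuous_on UNIV f" using GDERIV_continuous f(1) by blast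
  have bc: "continuous_on UNIV bump" using GDERIV_continuous GDERIV_bump by blast
  have h_der: "GDERIV (h n) x :> h' n x" for n x
  proof -
    have "((\<lambda>x. bump (r n *\<^sub>R x)) has_derivative (\<lambda>v. inner (r n *\<^sub>R v) (bump_grad (r n *\<^sub>R x)))) (at x)"
      by (rule has_derivative_compose[OF _ GDERIV_bump[unfolded gderiv_def], where f="\<lambda>x. r n *\<^sub>R x"])
        (auto intro!: derivative_eq_intros)
    with f(1)[of x] show ?thesis unfolding gderiv_def h_def[abs_def] h'_def
      by (auto intro!: derivative_eq_intros simp: inner_diff_right)
  qed
  have h_cont: "continuous_on UNIV (h n)" for n using GDERIV_continuous h_der by blast
  have h'_cont: "continuous_on UNIV (h' n)" for n unfolding h'_def
    by (intro continuous_intros f(2) continuous_on_compose2[OF continuous_bump_grad]) auto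
  have h_supp: "h n x = 0" if "norm x > max \<rho> (real (Suc n))" for n x
  proof -
    have "norm (r n *\<^sub>R x) \<ge> 1" using that by (simp add: r_def field_simps)
    then show ?thesis using that f(3)[of x] bump_eq_0[of "r n *\<^sub>R x"] by (simp add: h_def)
  qed
  obtain F where F: "F \<ge> 0" "\<And>x. norm (f x) \<le> F"
    by (rule bounded_compactly_supported[OF fc f(3)]) auto
  obtain F' where F': "F' \<ge> 0" "\<And>x. norm (f' x) \<le> F'"
    by (rule bounded_compactly_supported[OF f(2) gradient_eq_0_outside_support[OF f(1) f(3)]]) auto
  have h_bound: "\<bar>(h n x)\<^sup>2\<bar> \<le> (F + \<bar>m\<bar>)\<^sup>2" for n x
  proof -
    have "\<bar>h n x\<bar> \<le> \<bar>f x\<bar> + \<bar>m\<bar> * \<bar>bump (r n *\<^sub>R x)\<bar>"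
      using abs_triangle_ineq4 by (simp add: h_def flip: abs_mult)
    also have "\<dots> \<le> F + \<bar>m\<bar> * 1"
      using F(2)[of x] bump_le_1 by (intro add_mono mult_left_mono) auto
    finally have "\<bar>h n x\<bar>\<^sup>2 \<le> (F + \<bar>m\<bar>)\<^sup>2" by (intro power_mono) auto
    then show ?thesis by simp
  qed
  have h'_bound: "\<bar>(norm (h' n x))\<^sup>2\<bar> \<le> (F' + \<bar>m\<bar> * 4)\<^sup>2" for n x
  proof -
    have "norm (h' n x) \<le> norm (f' x) + norm ((m * r n) *\<^sub>R bump_grad (r n *\<^sub>R x))"
      unfolding h'_def by (rule norm_triangle_ineq4)
    also have "norm ((m * r n) *\<^sub>R bump_grad (r n *\<^sub>R x)) \<le> (\<bar>m\<bar> * 1) * 4"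
      unfolding norm_scaleR abs_mult using r[of n]
      by (intro mult_mono norm_bump_grad_le) auto
    finally have "norm (h' n x) \<le> F' + \<bar>m\<bar> * 4" using F'(2)[of x] by simp
    then have "(norm (h' n x))\<^sup>2 \<le> (F' + \<bar>m\<bar> * 4)\<^sup>2" by (intro power_mono) auto
    then show ?thesis by simp
  qed
  have h_lim: "(\<lambda>n. h n x) \<longlonglongrightarrow> f x - m" for x
  proof -
    have "(\<lambda>n. r n *\<^sub>R x) \<longlonglongrightarrow> 0 *\<^sub>R x" using r_lim by (intro tendsto_intros)
    with bc have "(\<lambda>n. bump (r n *\<^sub>R x)) \<longlonglongrightarrow> bump (0 *\<^sub>R x)"
      by (rule continuous_on_tendsto_compose) auto
    from tendsto_diff[OF tendsto_const tendsto_mult_left[OF this]]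
    have "(\<lambda>n. f x - m * bump (r n *\<^sub>R x)) \<longlonglongrightarrow> f x - m * bump (0 *\<^sub>R x)" .
    then show ?thesis by (simp add: h_def bump_def)
  qed
  have h'_lim: "(\<lambda>n. h' n x) \<longlonglongrightarrow> f' x" for x
  proof -
    have "(\<lambda>n. r n *\<^sub>R x) \<longlonglongrightarrow> 0 *\<^sub>R x" using r_lim by (intro tendsto_intros)
    with continuous_bump_grad have "(\<lambda>n. bump_grad (r n *\<^sub>R x)) \<longlonglongrightarrow> bump_grad (0 *\<^sub>R x)"
      by (rule continuous_on_tendsto_compose) auto
    from tendsto_diff[OF tendsto_const tendsto_scaleR[OF tendsto_mult_left[OF r_lim] this]]
    have "(\<lambda>n. f' x - (m * r n) *\<^sub>R bump_grad (r n *\<^sub>R x)) \<longlonglongrightarrow> f' x - (m * 0) *\<^sub>R bump_grad (0 *\<^sub>R x)" .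
    then show ?thesis by (simp add: h'_def)
  qed
  note [measurable] = borel_measurable_continuous_onI[OF fc] borel_measurable_continuous_onI[OF f(2)]
    borel_measurable_continuous_onI[OF h_cont] borel_measurable_continuous_onI[OF h'_cont]
  have lim_h: "(\<lambda>n. \<integral>x. (h n x)\<^sup>2 * exp (- U x) \<partial>lborel) \<longlonglongrightarrow> (\<integral>x. (f x - m)\<^sup>2 * exp (- U x) \<partial>lborel)"
    by (rule integral_weighted_bounded_convergence[OF w _ _ h_bound]) (measurable, intro tendsto_power h_lim)
  have lim_h': "(\<lambda>n. \<integral>x. (norm (h' n x))\<^sup>2 * exp (- U x) \<partial>lborel) \<longlonglongrightarrow> (\<integral>x. (norm (f' x))\<^sup>2 * exp (- U x) \<partial>lborel)"
    by (rule integral_weighted_bounded_convergence[OF w _ _ h'_bound]) (measurable, intro tendsto_power tendsto_norm h'_lim)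
  have lim_ind: "(\<lambda>n. \<integral>x. (indicator (cball 0 R) x * (h n x)\<^sup>2) * exp (- U x) \<partial>lborel)
      \<longlonglongrightarrow> (\<integral>x. (indicator (cball 0 R) x * (f x - m)\<^sup>2) * exp (- U x) \<partial>lborel)"
  proof (rule integral_weighted_bounded_convergence[OF w])
    show "\<bar>indicator (cball 0 R) x * (h n x)\<^sup>2\<bar> \<le> (F + \<bar>m\<bar>)\<^sup>2" for n x
      using h_bound[of n x] by (auto simp: indicator_def)
    show "(\<lambda>x. indicator (cball 0 R) x * (h n x)\<^sup>2) \<in> borel_measurable lborel" for n
      by (intro borel_measurable_times borel_measurable_indicator) auto
    show "(\<lambda>x. indicator (cball 0 R) x * (f x - m)\<^sup>2) \<in> borel_measurable lborel"
      by (intro borel_measurable_times borel_measurable_indicator) auto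
  qed (intro tendsto_mult_left tendsto_power h_lim)
  show ?thesis
  proof (rule LIMSEQ_le[OF lim_h tendsto_add[OF tendsto_mult_left[OF lim_ind] tendsto_mult_left[OF lim_h']]])
    show "\<exists>N. \<forall>n\<ge>N. (\<integral>x. (h n x)\<^sup>2 * exp (- U x) \<partial>lborel)
        \<le> C\<^sub>1 * (\<integral>x. (indicator (cball 0 R) x * (h n x)\<^sup>2) * exp (- U x) \<partial>lborel)
          + C\<^sub>2 * (\<integral>x. (norm (h' n x))\<^sup>2 * exp (- U x) \<partial>lborel)"
      by (intro exI[of _ 0] allI impI est[OF C1c_gradientI[OF h_der h'_cont h_supp]])
  qed
qed

section \<open>The Poincare inequality on convex sets\<close>

lemma nn_integral_lborel_affine:
  fixes w :: "'a::euclidean_space \<Rightarrow> ennreal"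
  assumes "w \<in> borel_measurable borel" "c > 0"
  shows "(\<integral>\<^sup>+x. w x \<partial>lborel) = ennreal (c ^ DIM('a)) * (\<integral>\<^sup>+x. w (a + c *\<^sub>R x) \<partial>lborel)"
  using assms
  by (subst lborel_affine[of c a]) (auto simp: nn_integral_density nn_integral_distr nn_integral_cmult)

text \<open>
The increment is the mean over \<open>[0, 1]\<close> of the directional derivative, and the square of a mean is at
most the mean of the square: the variance \<open>\<integral>(p - c)\<^sup>2\<close> is nonnegative.
\<close>
lemma square_increment_le_segment_integral:
  fixes f :: "'a::euclidean_space \<Rightarrow> real"
  assumes f: "\<And>x. GDERIV f x :> f' x" "continuous_on UNIV f'"
    and D: "norm (x - y) \<le> D"
  shows "ennreal ((f x - f y)\<^sup>2) \<le> (\<integral>\<^sup>+t\<in>{0..1}. ennreal (D\<^sup>2 * (norm (f' (y + t *\<^sub>R (x - y))))\<^sup>2) \<partial>lborel)"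
proof -
  define p where "p t = inner (x - y) (f' (y + t *\<^sub>R (x - y)))" for t
  define c where "c = f x - f y"
  define J :: "real \<Rightarrow> real" where "J = indicator {0..1}"
  have p_cont: "continuous_on UNIV p"
    unfolding p_def by (intro continuous_intros continuous_on_compose2[OF f(2)]) auto
  have isC: "isCont p t" for t using p_cont by (simp add: continuous_on_eq_continuous_at)
  have int_p: "integrable lborel (\<lambda>t. p t * J t)" and eq_p: "(\<integral>t. p t * J t \<partial>lborel) = c"
  proof -
    show "integrable lborel (\<lambda>t. p t * J t)"
      unfolding J_def using isC by (intro borel_integrable_atLeastAtMost)
    have "(\<integral>t. p t * J t \<partial>lborel) = f (y + 1 *\<^sub>R (x - y)) - f (y + 0 *\<^sub>R (x - y))"
      unfolding J_def p_def using isC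
      by (intro integral_FTC_Icc_real GDERIV_line[OF f(1)]) (auto simp: p_def[abs_def])
    then show "(\<integral>t. p t * J t \<partial>lborel) = c" by (simp add: c_def)
  qed
  have int_p2: "integrable lborel (\<lambda>t. (p t)\<^sup>2 * J t)"
    unfolding J_def using isC by (intro borel_integrable_atLeastAtMost continuous_intros)
  have int_J: "integrable lborel J" "(\<integral>t. J t \<partial>lborel) = 1"
    by (auto simp: J_def)
  have "0 \<le> (\<integral>t. (p t - c)\<^sup>2 * J t \<partial>lborel)"
    by (intro Bochner_Integration.integral_nonneg) (simp add: J_def)
  also have "(\<lambda>t. (p t - c)\<^sup>2 * J t) = (\<lambda>t. (p t)\<^sup>2 * J t - (2 * c) * (p t * J t) + c\<^sup>2 * J t)"
    by (simp add: power2_diff algebra_simps fun_eq_iff)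
  also have "(\<integral>t. (p t)\<^sup>2 * J t - (2 * c) * (p t * J t) + c\<^sup>2 * J t \<partial>lborel) = (\<integral>t. (p t)\<^sup>2 * J t \<partial>lborel) - c\<^sup>2"
    using int_p int_p2 int_J eq_p by (simp add: power2_eq_square)
  finally have "ennreal (c\<^sup>2) \<le> ennreal (\<integral>t. (p t)\<^sup>2 * J t \<partial>lborel)"
    by (intro ennreal_leI) simp
  also have "\<dots> = (\<integral>\<^sup>+t. ennreal ((p t)\<^sup>2 * J t) \<partial>lborel)"
    using int_p2 by (intro nn_integral_eq_integral[symmetric]) (auto simp: J_def)
  also have "\<dots> \<le> (\<integral>\<^sup>+t\<in>{0..1}. ennreal (D\<^sup>2 * (norm (f' (y + t *\<^sub>R (x - y))))\<^sup>2) \<partial>lborel)"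
  proof (rule nn_integral_mono)
    fix t
    have "\<bar>p t\<bar> \<le> D * norm (f' (y + t *\<^sub>R (x - y)))"
      unfolding p_def by (rule order_trans[OF Cauchy_Schwarz_ineq2 mult_right_mono[OF D]]) simp
    then have "\<bar>p t\<bar>\<^sup>2 \<le> (D * norm (f' (y + t *\<^sub>R (x - y))))\<^sup>2" by (intro power_mono) auto
    then show "ennreal ((p t)\<^sup>2 * J t) \<le> ennreal (D\<^sup>2 * (norm (f' (y + t *\<^sub>R (x - y))))\<^sup>2) * indicator {0..1} t"
      by (auto simp: J_def indicator_def power_mult_distrib intro!: ennreal_leI)
  qed
  finally show ?thesis by (simp add: c_def)
qed

text \<open>
For fixed \<open>y \<in> S\<close>, the affine map from \<open>x\<close> to \<open>y + t *\<^sub>R (x - y)\<close> sends the convex set \<open>S\<close> into itself and has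
Jacobian \<open>t ^ DIM('a)\<close>. The change of variables therefore costs at most \<open>2 ^ DIM('a)\<close> as long as
\<open>t \<ge> 1 / 2\<close>.
\<close>
lemma nn_integral_interpolation_le_half:
  fixes S :: "'a::euclidean_space set" and w :: "'a \<Rightarrow> ennreal"
  assumes S: "convex S" and S_meas [measurable]: "S \<in> sets borel"
    and w [measurable]: "w \<in> borel_measurable borel" and t: "1 / 2 \<le> t" "t \<le> 1"
  shows "(\<integral>\<^sup>+y\<in>S. (\<integral>\<^sup>+x\<in>S. w (y + t *\<^sub>R (x - y)) \<partial>lborel) \<partial>lborel)
    \<le> ennreal (2 ^ DIM('a)) * emeasure lborel S * (\<integral>\<^sup>+x\<in>S. w x \<partial>lborel)"
proof -
  define W where "W x = w x * indicator S x" for x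
  have W [measurable]: "W \<in> borel_measurable borel" unfolding W_def by measurable
  have inner_le: "(\<integral>\<^sup>+x\<in>S. w (y + t *\<^sub>R (x - y)) \<partial>lborel) \<le> ennreal (2 ^ DIM('a)) * (\<integral>\<^sup>+x. W x \<partial>lborel)"
    if "y \<in> S" for y
  proof -
    have "(\<integral>\<^sup>+x\<in>S. w (y + t *\<^sub>R (x - y)) \<partial>lborel) \<le> (\<integral>\<^sup>+x. W ((1 - t) *\<^sub>R y + t *\<^sub>R x) \<partial>lborel)"
    proof (rule nn_integral_mono)
      fix x
      have "y + t *\<^sub>R (x - y) = (1 - t) *\<^sub>R y + t *\<^sub>R x" by (simp add: algebra_simps)
      moreover have "(1 - t) *\<^sub>R y + t *\<^sub>R x \<in> S" if "x \<in> S"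
        using S \<open>y \<in> S\<close> that t by (intro convexD) auto
      ultimately show "w (y + t *\<^sub>R (x - y)) * indicator S x \<le> W ((1 - t) *\<^sub>R y + t *\<^sub>R x)"
        by (auto simp: W_def indicator_def)
    qed
    also have "\<dots> = ennreal (2 ^ DIM('a) * (1 / 2) ^ DIM('a)) * (\<integral>\<^sup>+x. W ((1 - t) *\<^sub>R y + t *\<^sub>R x) \<partial>lborel)"
      by (simp flip: power_mult_distrib)
    also have "\<dots> \<le> ennreal (2 ^ DIM('a) * t ^ DIM('a)) * (\<integral>\<^sup>+x. W ((1 - t) *\<^sub>R y + t *\<^sub>R x) \<partial>lborel)"
      using t by (intro mult_right_mono ennreal_leI mult_left_mono power_mono) auto
    also have "\<dots> = ennreal (2 ^ DIM('a)) * (\<integral>\<^sup>+x. W x \<partial>lborel)"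
      using t by (subst nn_integral_lborel_affine[OF W, of t "(1 - t) *\<^sub>R y"]) (auto simp: ennreal_mult mult.assoc)
    finally show ?thesis .
  qed
  have "(\<integral>\<^sup>+y\<in>S. (\<integral>\<^sup>+x\<in>S. w (y + t *\<^sub>R (x - y)) \<partial>lborel) \<partial>lborel)
      \<le> (\<integral>\<^sup>+y\<in>S. (ennreal (2 ^ DIM('a)) * (\<integral>\<^sup>+x. W x \<partial>lborel)) \<partial>lborel)"
    using inner_le by (intro nn_integral_mono) (auto simp: indicator_def)
  also have "\<dots> = ennreal (2 ^ DIM('a)) * (\<integral>\<^sup>+x. W x \<partial>lborel) * emeasure lborel S"
    by (subst nn_integral_cmult_indicator) auto
  finally show ?thesis by (simp add: W_def mult_ac)
qed

text \<open>
For \<open>t < 1 / 2\<close> the roles of \<open>x\<close> and \<open>y\<close> are exchanged, which replaces \<open>t\<close> by \<open>1 - t\<close> and keeps the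
Jacobian away from zero.
\<close>
lemma nn_integral_interpolation_le:
  fixes S :: "'a::euclidean_space set" and w :: "'a \<Rightarrow> ennreal"
  assumes S: "convex S" and S_meas [measurable]: "S \<in> sets borel"
    and w [measurable]: "w \<in> borel_measurable borel" and t: "0 \<le> t" "t \<le> 1"
  shows "(\<integral>\<^sup>+y\<in>S. (\<integral>\<^sup>+x\<in>S. w (y + t *\<^sub>R (x - y)) \<partial>lborel) \<partial>lborel)
    \<le> ennreal (2 ^ DIM('a)) * emeasure lborel S * (\<integral>\<^sup>+x\<in>S. w x \<partial>lborel)"
proof (cases "1 / 2 \<le> t")
  case True
  then show ?thesis using assms by (intro nn_integral_interpolation_le_half)
next
  case False
  have "(\<integral>\<^sup>+y\<in>S. (\<integral>\<^sup>+x\<in>S. w (y + t *\<^sub>R (x - y)) \<partial>lborel) \<partial>lborel)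
      = (\<integral>\<^sup>+y. \<integral>\<^sup>+x. w (y + t *\<^sub>R (x - y)) * indicator S x * indicator S y \<partial>lborel \<partial>lborel)"
    by (simp add: nn_integral_multc)
  also have "\<dots> = (\<integral>\<^sup>+x. \<integral>\<^sup>+y. w (y + t *\<^sub>R (x - y)) * indicator S x * indicator S y \<partial>lborel \<partial>lborel)"
    by (rule lborel_pair.Fubini') measurable
  also have "\<dots> = (\<integral>\<^sup>+x. \<integral>\<^sup>+y. w (x + (1 - t) *\<^sub>R (y - x)) * indicator S y * indicator S x \<partial>lborel \<partial>lborel)"
    by (simp add: algebra_simps)
  also have "\<dots> = (\<integral>\<^sup>+x\<in>S. (\<integral>\<^sup>+y\<in>S. w (x + (1 - t) *\<^sub>R (y - x)) \<partial>lborel) \<partial>lborel)"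
    by (simp add: nn_integral_multc)
  also have "\<dots> \<le> ennreal (2 ^ DIM('a)) * emeasure lborel S * (\<integral>\<^sup>+x\<in>S. w x \<partial>lborel)"
    using False t assms by (intro nn_integral_interpolation_le_half) auto
  finally show ?thesis .
qed

text \<open>
Each increment is bounded by the gradient along the segment; for a fixed position \<open>t\<close> on the segment,
averaging over both endpoints spreads that point over \<open>S\<close> with bounded density. Both sides are
nonnegative integrals, so Tonelli's theorem moves the integral over \<open>t\<close> outside without any
integrability to check.
\<close>
lemma poincare_convex:
  fixes f :: "'a::euclidean_space \<Rightarrow> real"
  assumes S: "convex S" and S_meas [measurable]: "S \<in> sets borel"
    and f: "\<And>x. GDERIV f x :> f' x" "continuous_on UNIV f'"
    and D: "\<And>x y. x \<in> S \<Longrightarrow> y \<in> S \<Longrightarrow> norm (x - y) \<le> D"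
  shows "(\<integral>\<^sup>+y\<in>S. (\<integral>\<^sup>+x\<in>S. ennreal ((f x - f y)\<^sup>2) \<partial>lborel) \<partial>lborel)
    \<le> ennreal (2 ^ DIM('a)) * emeasure lborel S * (\<integral>\<^sup>+x\<in>S. ennreal (D\<^sup>2 * (norm (f' x))\<^sup>2) \<partial>lborel)"
proof -
  define w where "w x = ennreal (D\<^sup>2 * (norm (f' x))\<^sup>2)" for x
  note [measurable] = borel_measurable_continuous_onI[OF f(2)]
  have w [measurable]: "w \<in> borel_measurable borel" unfolding w_def by measurable
  have "(\<integral>\<^sup>+y\<in>S. (\<integral>\<^sup>+x\<in>S. ennreal ((f x - f y)\<^sup>2) \<partial>lborel) \<partial>lborel)
      \<le> (\<integral>\<^sup>+y\<in>S. (\<integral>\<^sup>+x\<in>S. (\<integral>\<^sup>+t\<in>{0..1}. w (y + t *\<^sub>R (x - y)) \<partial>lborel) \<partial>lborel) \<partial>lborel)"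
  proof -
    have "ennreal ((f x - f y)\<^sup>2) \<le> (\<integral>\<^sup>+t\<in>{0..1}. w (y + t *\<^sub>R (x - y)) \<partial>lborel)" if "x \<in> S" "y \<in> S" for x y
      unfolding w_def by (rule square_increment_le_segment_integral[OF f D[OF that]])
    then show ?thesis
      by (intro nn_integral_mono) (auto simp: indicator_def intro!: nn_integral_mono)
  qed
  also have "\<dots> = (\<integral>\<^sup>+y. \<integral>\<^sup>+x. \<integral>\<^sup>+t. w (y + t *\<^sub>R (x - y)) * indicator {0..1} t * indicator S x * indicator S y \<partial>lborel \<partial>lborel \<partial>lborel)"
    by (simp add: nn_integral_multc)
  also have "\<dots> = (\<integral>\<^sup>+y. \<integral>\<^sup>+t. \<integral>\<^sup>+x. w (y + t *\<^sub>R (x - y)) * indicator {0..1} t * indicator S x * indicator S y \<partial>lborel \<partial>lborel \<partial>lborel)"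
    by (intro nn_integral_cong lborel_pair.Fubini') measurable
  also have "\<dots> = (\<integral>\<^sup>+t. \<integral>\<^sup>+y. \<integral>\<^sup>+x. w (y + t *\<^sub>R (x - y)) * indicator {0..1} t * indicator S x * indicator S y \<partial>lborel \<partial>lborel \<partial>lborel)"
    by (rule lborel_pair.Fubini') measurable
  also have "\<dots> = (\<integral>\<^sup>+t. \<integral>\<^sup>+y. \<integral>\<^sup>+x. w (y + t *\<^sub>R (x - y)) * indicator S x * indicator S y * indicator {0..1} t \<partial>lborel \<partial>lborel \<partial>lborel)"
    by (simp add: mult_ac)
  also have "\<dots> = (\<integral>\<^sup>+t\<in>{0..1}. (\<integral>\<^sup>+y\<in>S. (\<integral>\<^sup>+x\<in>S. w (y + t *\<^sub>R (x - y)) \<partial>lborel) \<partial>lborel) \<partial>lborel)"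
    by (simp add: nn_integral_multc)
  also have "\<dots> \<le> (\<integral>\<^sup>+t\<in>{0..1::real}. (ennreal (2 ^ DIM('a)) * emeasure lborel S * (\<integral>\<^sup>+x\<in>S. w x \<partial>lborel)) \<partial>lborel)"
    using nn_integral_interpolation_le[OF S S_meas w] by (intro nn_integral_mono) (auto simp: indicator_def)
  also have "\<dots> = ennreal (2 ^ DIM('a)) * emeasure lborel S * (\<integral>\<^sup>+x\<in>S. w x \<partial>lborel)"
    by (subst nn_integral_cmult_indicator) auto
  finally show ?thesis by (simp add: w_def)
qed

section \<open>From growth to the Poincare inequality\<close>

text \<open>
For every \<open>m\<close> the variance is at most the integral of \<open>(f - m)\<^sup>2\<close>, which the estimate at infinity reduces
to a ball \<open>B\<close>. Instead of choosing \<open>m\<close> as an average, one takes \<open>m = f y\<close> and integrates over \<open>y \<in> B\<close>, so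
that the double integral of \<open>poincare_convex\<close> appears. The measure of \<open>B\<close> cancels in the end.
\<close>
lemma poincare_of_growth:
  fixes U :: "'a::euclidean_space \<Rightarrow> real"
  assumes U: "\<And>x. GDERIV U x :> U' x" "continuous_on UNIV U'"
    and a: "a > 0" and growth: "\<And>x. inner x (U' x) \<ge> a * (norm x)\<^sup>2 - b * norm x"
    and w: "integrable lborel (\<lambda>x. exp (- U x))" and w1: "(\<integral>x. exp (- U x) \<partial>lborel) = 1"
  obtains C where "C > 0"
    and "\<And>f f'. C1c_gradient f f' \<Longrightarrow>
      (\<integral>x. (f x)\<^sup>2 * exp (- U x) \<partial>lborel) - (\<integral>x. f x * exp (- U x) \<partial>lborel)\<^sup>2
        \<le> C * (\<integral>x. (norm (f' x))\<^sup>2 * exp (- U x) \<partial>lborel)"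
proof -
  obtain R C\<^sub>1 C\<^sub>2 where RC: "R > 0" "C\<^sub>1 > 0" "C\<^sub>2 > 0"
    and est: "\<And>h h'. C1c_gradient h h' \<Longrightarrow>
      (\<integral>x. (h x)\<^sup>2 * exp (- U x) \<partial>lborel)
        \<le> C\<^sub>1 * (\<integral>x. (indicator (cball 0 R) x * (h x)\<^sup>2) * exp (- U x) \<partial>lborel)
          + C\<^sub>2 * (\<integral>x. (norm (h' x))\<^sup>2 * exp (- U x) \<partial>lborel)"
    using lyapunov_estimate[OF U a growth] by blast
  define B where "B = cball (0::'a) R"
  define D where "D = 2 * R"
  have B_meas [measurable]: "B \<in> sets borel" by (simp add: B_def)
  have Uc [continuous_intros]: "continuous_on UNIV U" using GDERIV_continuous U(1) by blast
  have wc: "continuous_on B (\<lambda>x. exp (- U x))"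
    using Uc by (intro continuous_intros continuous_on_subset[OF Uc]) auto
  have B_compact: "compact B" "B \<noteq> {}" using RC by (auto simp: B_def)
  obtain x\<^sub>0 where x\<^sub>0: "\<And>x. x \<in> B \<Longrightarrow> exp (- U x) \<le> exp (- U x\<^sub>0)"
    using continuous_attains_sup[OF B_compact wc] by blast
  obtain x\<^sub>1 where x\<^sub>1: "\<And>x. x \<in> B \<Longrightarrow> exp (- U x\<^sub>1) \<le> exp (- U x)"
    using continuous_attains_inf[OF B_compact wc] by blast
  define W where "W = exp (- U x\<^sub>0)"
  define v where "v = exp (- U x\<^sub>1)"
  have Wv: "W > 0" "v > 0" by (auto simp: W_def v_def)
  define \<beta> where "\<beta> = measure lborel B"
  have \<beta>: "\<beta> > 0" "emeasure lborel B = ennreal \<beta>"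
  proof -
    show "\<beta> > 0" unfolding \<beta>_def B_def using RC content_cball_pos by auto
    show "emeasure lborel B = ennreal \<beta>"
      unfolding \<beta>_def B_def using emeasure_lborel_cball_finite[of "0::'a" R]
      by (intro emeasure_eq_ennreal_measure) (auto simp: less_top)
  qed
  define C where "C = C\<^sub>1 * W * 2 ^ DIM('a) * (D\<^sup>2 / v) + C\<^sub>2"
  show thesis
  proof (rule that[of C])
    show "C > 0" using RC Wv by (simp add: C_def D_def add_nonneg_pos)
    fix f :: "'a \<Rightarrow> real" and f'
    assume f_C1c: "C1c_gradient f f'"
    then obtain \<rho> where f: "\<And>x. GDERIV f x :> f' x" "continuous_on UNIV f'" "\<And>x. norm x > \<rho> \<Longrightarrow> f x = 0"
      by (auto simp: C1c_gradient_def)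
    define V where "V = (\<integral>x. (f x)\<^sup>2 * exp (- U x) \<partial>lborel) - (\<integral>x. f x * exp (- U x) \<partial>lborel)\<^sup>2"
    define E where "E = (\<integral>x. (norm (f' x))\<^sup>2 * exp (- U x) \<partial>lborel)"
    have fc [continuous_intros]: "continuous_on UNIV f" using GDERIV_continuous f(1) by blast
    note [measurable] = borel_measurable_continuous_onI[OF fc] borel_measurable_continuous_onI[OF f(2)]
      borel_measurable_continuous_onI[OF Uc]
    have int_f2: "integrable lborel (\<lambda>x. (f x)\<^sup>2 * exp (- U x))" and int_f: "integrable lborel (\<lambda>x. f x * exp (- U x))"
      using f(3) by (auto intro!: integrable_compactly_supported[where R=\<rho>] continuous_intros)
    have int_f': "integrable lborel (\<lambda>x. (norm (f' x))\<^sup>2 * exp (- U x))"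
      using gradient_eq_0_outside_support[OF f(1) f(3)] f(2)
      by (intro integrable_compactly_supported[where R=\<rho>] continuous_intros) auto
    have E0: "E \<ge> 0" unfolding E_def by (intro Bochner_Integration.integral_nonneg) auto
    have V_le: "V \<le> (\<integral>x. (f x - m)\<^sup>2 * exp (- U x) \<partial>lborel)" for m
    proof -
      have "(\<integral>x. (f x - m)\<^sup>2 * exp (- U x) \<partial>lborel)
          = (\<integral>x. (f x)\<^sup>2 * exp (- U x) - (2 * m) * (f x * exp (- U x)) + m\<^sup>2 * exp (- U x) \<partial>lborel)"
        by (intro Bochner_Integration.integral_cong) (auto simp: power2_diff algebra_simps)
      also have "\<dots> = (\<integral>x. (f x)\<^sup>2 * exp (- U x) \<partial>lborel) - (2 * m) * (\<integral>x. f x * exp (- U x) \<partial>lborel) + m\<^sup>2"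
        using int_f2 int_f w w1 by simp
      also have "\<dots> = V + ((\<integral>x. f x * exp (- U x) \<partial>lborel) - m)\<^sup>2"
        by (simp add: V_def power2_diff)
      finally show ?thesis by simp
    qed
    have V_m: "ennreal V \<le> ennreal (C\<^sub>1 * W) * (\<integral>\<^sup>+x\<in>B. ennreal ((f x - m)\<^sup>2) \<partial>lborel) + ennreal (C\<^sub>2 * E)" for m
    proof -
      define j where "j x = indicator B x * (f x - m)\<^sup>2" for x
      have "integrable lborel (\<lambda>x. indicator B x *\<^sub>R (f x - m)\<^sup>2)"
        using B_compact(1) by (intro borel_integrable_compact continuous_intros continuous_on_subset[OF fc]) auto
      then have int_j: "integrable lborel j" by (simp add: j_def[abs_def])
      have "integrable lborel (\<lambda>x. indicator B x *\<^sub>R ((f x - m)\<^sup>2 * exp (- U x)))"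
        using B_compact(1)
        by (intro borel_integrable_compact continuous_intros continuous_on_subset[OF fc] continuous_on_subset[OF Uc]) auto
      then have int_jw: "integrable lborel (\<lambda>x. j x * exp (- U x))" by (simp add: j_def[abs_def] mult.assoc)
      have "(\<integral>x. j x * exp (- U x) \<partial>lborel) \<le> (\<integral>x. W * j x \<partial>lborel)"
      proof (rule integral_mono[OF int_jw])
        show "j x * exp (- U x) \<le> W * j x" for x
          using x\<^sub>0[of x] mult_right_mono[of "exp (- U x)" W "(f x - m)\<^sup>2"]
          by (auto simp: j_def indicator_def W_def mult.commute)
      qed (use int_j in auto)
      then have "C\<^sub>1 * (\<integral>x. j x * exp (- U x) \<partial>lborel) \<le> C\<^sub>1 * (\<integral>x. W * j x \<partial>lborel)"
        using RC by (intro mult_left_mono) auto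
      moreover have "(\<integral>x. (f x - m)\<^sup>2 * exp (- U x) \<partial>lborel) \<le> C\<^sub>1 * (\<integral>x. j x * exp (- U x) \<partial>lborel) + C\<^sub>2 * E"
        unfolding j_def B_def E_def by (rule estimate_add_constant[OF est w f_C1c])
      ultimately have "V \<le> C\<^sub>1 * W * (\<integral>x. j x \<partial>lborel) + C\<^sub>2 * E"
        using V_le[of m] by (simp add: mult.assoc)
      then have "ennreal V \<le> ennreal (C\<^sub>1 * W * (\<integral>x. j x \<partial>lborel) + C\<^sub>2 * E)" by (rule ennreal_leI)
      also have "\<dots> = ennreal (C\<^sub>1 * W) * ennreal (\<integral>x. j x \<partial>lborel) + ennreal (C\<^sub>2 * E)"
        using RC Wv E0 by (subst ennreal_plus) (auto simp: ennreal_mult j_def intro!: mult_nonneg_nonneg Bochner_Integration.integral_nonneg)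
      also have "ennreal (\<integral>x. j x \<partial>lborel) = (\<integral>\<^sup>+x. ennreal (j x) \<partial>lborel)"
        by (rule nn_integral_eq_integral[OF int_j, symmetric]) (simp add: j_def)
      also have "\<dots> = (\<integral>\<^sup>+x\<in>B. ennreal ((f x - m)\<^sup>2) \<partial>lborel)"
        by (intro nn_integral_cong) (auto simp: j_def indicator_def)
      finally show ?thesis .
    qed
    \<comment> \<open>Inside \<open>B\<close>, Lebesgue measure is at most \<open>1 / v\<close> times the weighted measure.\<close>
    have loc: "(\<integral>\<^sup>+x\<in>B. ennreal (D\<^sup>2 * (norm (f' x))\<^sup>2) \<partial>lborel) \<le> ennreal (D\<^sup>2 / v * E)"
    proof -
      have "(\<integral>\<^sup>+x\<in>B. ennreal (D\<^sup>2 * (norm (f' x))\<^sup>2) \<partial>lborel)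
          \<le> (\<integral>\<^sup>+x. ennreal (D\<^sup>2 / v * ((norm (f' x))\<^sup>2 * exp (- U x))) \<partial>lborel)"
      proof (rule nn_integral_mono)
        fix x
        have "D\<^sup>2 * (norm (f' x))\<^sup>2 \<le> D\<^sup>2 / v * ((norm (f' x))\<^sup>2 * exp (- U x))" if "x \<in> B"
        proof -
          have "D\<^sup>2 / v * (norm (f' x))\<^sup>2 * v \<le> D\<^sup>2 / v * (norm (f' x))\<^sup>2 * exp (- U x)"
            using x\<^sub>1[OF that] Wv by (intro mult_left_mono) (auto simp: v_def)
          then show ?thesis using Wv by (simp add: mult.assoc)
        qed
        then show "ennreal (D\<^sup>2 * (norm (f' x))\<^sup>2) * indicator B x \<le> ennreal (D\<^sup>2 / v * ((norm (f' x))\<^sup>2 * exp (- U x)))"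
          by (auto simp: indicator_def intro!: ennreal_leI)
      qed
      also have "\<dots> = ennreal (D\<^sup>2 / v * E)"
        unfolding E_def using int_f' Wv
        by (subst nn_integral_eq_integral) auto
      finally show ?thesis .
    qed
    have "norm (x - y) \<le> D" if "x \<in> B" "y \<in> B" for x y
      using that norm_triangle_ineq4[of x y] by (simp add: B_def D_def)
    then have loc2: "(\<integral>\<^sup>+y\<in>B. (\<integral>\<^sup>+x\<in>B. ennreal ((f x - f y)\<^sup>2) \<partial>lborel) \<partial>lborel)
        \<le> ennreal (2 ^ DIM('a)) * emeasure lborel B * (\<integral>\<^sup>+x\<in>B. ennreal (D\<^sup>2 * (norm (f' x))\<^sup>2) \<partial>lborel)"
      using B_meas f by (intro poincare_convex) (auto simp: B_def)
    \<comment> \<open>The estimates \<open>V_m\<close> with \<open>m = f y\<close> are integrated over \<open>y \<in> B\<close>.\<close>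
    have "ennreal V * emeasure lborel B = (\<integral>\<^sup>+y\<in>B. ennreal V \<partial>lborel)"
      by (subst nn_integral_cmult_indicator) auto
    also have "\<dots> \<le> (\<integral>\<^sup>+y\<in>B. (ennreal (C\<^sub>1 * W) * (\<integral>\<^sup>+x\<in>B. ennreal ((f x - f y)\<^sup>2) \<partial>lborel) + ennreal (C\<^sub>2 * E)) \<partial>lborel)"
      using V_m by (intro nn_integral_mono) (auto simp: indicator_def)
    also have "\<dots> = ennreal (C\<^sub>1 * W) * (\<integral>\<^sup>+y\<in>B. (\<integral>\<^sup>+x\<in>B. ennreal ((f x - f y)\<^sup>2) \<partial>lborel) \<partial>lborel) + ennreal (C\<^sub>2 * E) * emeasure lborel B"
    proof -
      define g where "g y = (\<integral>\<^sup>+x\<in>B. ennreal ((f x - f y)\<^sup>2) \<partial>lborel)" for y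
      have g [measurable]: "g \<in> borel_measurable borel" unfolding g_def by measurable
      have "(\<integral>\<^sup>+y\<in>B. (ennreal (C\<^sub>1 * W) * g y + ennreal (C\<^sub>2 * E)) \<partial>lborel)
          = (\<integral>\<^sup>+y. ennreal (C\<^sub>1 * W) * (g y * indicator B y) + ennreal (C\<^sub>2 * E) * indicator B y \<partial>lborel)"
        by (intro nn_integral_cong) (auto simp: indicator_def)
      also have "\<dots> = ennreal (C\<^sub>1 * W) * (\<integral>\<^sup>+y\<in>B. g y \<partial>lborel) + ennreal (C\<^sub>2 * E) * emeasure lborel B"
        by (subst nn_integral_add) (auto simp: nn_integral_cmult nn_integral_cmult_indicator)
      finally show ?thesis unfolding g_def .
    qed
    also have "\<dots> \<le> ennreal (C\<^sub>1 * W) * (ennreal (2 ^ DIM('a)) * emeasure lborel B * ennreal (D\<^sup>2 / v * E)) + ennreal (C\<^sub>2 * E) * emeasure lborel B"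
      by (intro add_right_mono mult_left_mono order_trans[OF loc2] loc) auto
    also have "\<dots> = ennreal (C * E) * emeasure lborel B"
    proof -
      have nn: "0 \<le> C\<^sub>1 * W" "0 \<le> D\<^sup>2 / v * E" "0 \<le> C\<^sub>2 * E" "0 \<le> \<beta>" using RC Wv E0 \<beta> by auto
      have "ennreal (C\<^sub>1 * W) * (ennreal (2 ^ DIM('a)) * ennreal \<beta> * ennreal (D\<^sup>2 / v * E)) + ennreal (C\<^sub>2 * E) * ennreal \<beta>
        = ennreal (C\<^sub>1 * W * (2 ^ DIM('a) * \<beta> * (D\<^sup>2 / v * E)) + C\<^sub>2 * E * \<beta>)"
        using nn by (simp add: ennreal_plus ennreal_mult del: times_divide_eq_left)
      also have "C\<^sub>1 * W * (2 ^ DIM('a) * \<beta> * (D\<^sup>2 / v * E)) + C\<^sub>2 * E * \<beta> = C * E * \<beta>"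
        by (simp add: C_def algebra_simps)
      finally show ?thesis using nn \<open>C > 0\<close> E0 by (simp add: \<beta>(2) ennreal_mult)
    qed
    finally have "ennreal V * emeasure lborel B \<le> ennreal (C * E) * emeasure lborel B" .
    moreover have "emeasure lborel B \<noteq> 0" "emeasure lborel B \<noteq> top" using \<beta> by auto
    ultimately have "ennreal V \<le> ennreal (C * E)"
      by (simp only: mult.commute[of _ "emeasure lborel B"] ennreal_mult_le_mult_iff simp_thms)
    then have "V \<le> C * E" using E0 \<open>C > 0\<close> by (simp add: ennreal_le_iff)
    then show "(\<integral>x. (f x)\<^sup>2 * exp (- U x) \<partial>lborel) - (\<integral>x. f x * exp (- U x) \<partial>lborel)\<^sup>2
        \<le> C * (\<integral>x. (norm (f' x))\<^sup>2 * exp (- U x) \<partial>lborel)"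
      by (simp only: V_def E_def)
  qed
qed

lemma C2_D:
  fixes f :: "real ^ 'n \<Rightarrow> real"
  assumes "C2 f"
  shows "GDERIV f x :> grad f x"
    and "(grad f has_derivative (\<lambda>v. hessian f x *v v)) (at x)"
    and "continuous_on UNIV (grad f)"
proof -
  have diff: "f differentiable (at x)" "grad f differentiable (at x)" for x
    using assms by (auto simp: C2_def)
  show "GDERIV f x :> grad f x" by (rule GDERIV_grad[OF diff(1)])
  show "(grad f has_derivative (\<lambda>v. hessian f x *v v)) (at x)"
    using diff(2) unfolding hessian_def by (simp only: jacobian_works)
  show "continuous_on UNIV (grad f)"
    using diff(2) by (intro continuous_at_imp_continuous_on ballI differentiable_imp_continuous_within)
qed

theorem corollary1p10:
  fixes U :: "real ^ 'n \<Rightarrow> real" and K L :: real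
  assumes "C2 U"
    and "K > 0"
    and "\<And>x. pos_semidef (hessian U x + K *\<^sub>R mat 1)"
    and "prob_space (gibbs_measure U)"
    and "L > 0"
    and "(INF (x, y) \<in> {(x, y). norm (x - y) = L}. ereal (inner (grad U x - grad U y) (x - y))) > 0"
  shows "poincare_inequality (gibbs_measure U)"
proof -
  note U = C2_D[OF \<open>C2 U\<close>]
  have [measurable]: "U \<in> borel_measurable borel"
    using GDERIV_continuous[OF U(1)] by (rule borel_measurable_continuous_onI)
  have lower: "inner (grad U x - grad U y) (x - y) \<ge> - K * (norm (x - y))\<^sup>2" for x y
  proof (rule inner_increment_lower_bound[OF U(2)])
    show "inner v (hessian U x *v v) \<ge> - K * (norm v)\<^sup>2" for x v
      using assms(3)[of x]
      by (auto simp: pos_semidef_def matrix_vector_mult_add_rdistrib inner_add_right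
          scaleR_matrix_vector_assoc[symmetric] power2_norm_eq_inner dest!: spec[of _ v])
  qed
  obtain c where c: "0 < ereal c"
    "ereal c < (INF (x, y) \<in> {(x, y). norm (x - y) = L}. ereal (inner (grad U x - grad U y) (x - y)))"
    using ereal_dense2[OF assms(6)] by auto
  have at_L: "inner (grad U x - grad U y) (x - y) \<ge> c" if "norm (x - y) = L" for x y
  proof -
    have "(INF (x, y) \<in> {(x, y). norm (x - y) = L}. ereal (inner (grad U x - grad U y) (x - y)))
        \<le> ereal (inner (grad U x - grad U y) (x - y))"
      using that by (intro INF_lower2[of "(x, y)"]) auto
    with c(2) have "ereal c \<le> ereal (inner (grad U x - grad U y) (x - y))" by order
    then show ?thesis by simp
  qed
  obtain b where growth: "\<And>x. inner x (grad U x) \<ge> c / L\<^sup>2 * (norm x)\<^sup>2 - b * norm x"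
    using growth_of_gradient[OF lower at_L] \<open>L > 0\<close> \<open>K > 0\<close> c(1) by auto
  have gibbs: "(\<integral>x. g x \<partial>gibbs_measure U) = (\<integral>x. g x * exp (- U x) \<partial>lborel)"
    if "g \<in> borel_measurable borel" for g :: "real ^ 'n \<Rightarrow> real"
    unfolding gibbs_measure_def using that
    by (subst integral_density) (auto simp: mult.commute)
  have mass: "(\<integral>\<^sup>+x. ennreal (exp (- U x)) \<partial>lborel) = 1"
    using prob_space.emeasure_space_1[OF assms(4)]
    by (simp add: gibbs_measure_def emeasure_density)
  have w: "integrable lborel (\<lambda>x. exp (- U x))"
    using mass by (intro integrableI_nonneg) auto
  have w1: "(\<integral>x. exp (- U x) \<partial>lborel) = 1"
    using mass by (subst integral_eq_nn_integral) auto
  have a: "c / L\<^sup>2 > 0" using c(1) \<open>L > 0\<close> by simp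
  obtain C where "C > 0"
    and C: "\<And>f f'. C1c_gradient f f' \<Longrightarrow>
      (\<integral>x. (f x)\<^sup>2 * exp (- U x) \<partial>lborel) - (\<integral>x. f x * exp (- U x) \<partial>lborel)\<^sup>2
        \<le> C * (\<integral>x. (norm (f' x))\<^sup>2 * exp (- U x) \<partial>lborel)"
    using poincare_of_growth[OF U(1,3) a growth w w1] by blast
  show ?thesis
    unfolding poincare_inequality_def
  proof (intro exI[of _ C] conjI allI impI)
    fix f :: "real ^ 'n \<Rightarrow> real"
    assume "C2c f"
    then have f2: "C2 f" and "bounded {x. f x \<noteq> 0}"
      using compact_imp_bounded bounded_subset[OF _ closure_subset] by (auto simp: C2c_def)
    then obtain \<rho> where \<rho>: "\<And>x. f x \<noteq> 0 \<Longrightarrow> norm x \<le> \<rho>" by (auto simp: bounded_iff)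
    note f = C2_D[OF f2]
    have [measurable]: "f \<in> borel_measurable borel" "grad f \<in> borel_measurable borel"
      using GDERIV_continuous[OF f(1)] f(3) by (auto intro: borel_measurable_continuous_onI)
    have "(\<integral>x. (f x)\<^sup>2 * exp (- U x) \<partial>lborel) - (\<integral>x. f x * exp (- U x) \<partial>lborel)\<^sup>2
        \<le> C * (\<integral>x. (norm (grad f x))\<^sup>2 * exp (- U x) \<partial>lborel)"
      using \<rho> by (intro C C1c_gradientI[OF f(1,3), of \<rho>]) force
    then show "(\<integral>x. (f x)\<^sup>2 \<partial>gibbs_measure U) - (\<integral>x. f x \<partial>gibbs_measure U)\<^sup>2
        \<le> C * (\<integral>x. (norm (grad f x))\<^sup>2 \<partial>gibbs_measure U)"
      by (simp add: gibbs)
  qed (rule \<open>C > 0\<close>)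
qed

end
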